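(* Let $n,B,k\in\mathbb{N}$ with $k\ge2$ and $B\le n/k$, and let $f_j=1/j$ for $j\in[n]$. Let $h_1,\dots,h_k:[n]\to[B]$ be independent, truly (uniformly) random hash functions. For $i\in[n]$ define $$\tilde f_i=\min_{\ell\in[k]}\left(\sum_{j\in[n]}[h_\ell(j)=h_\ell(i)]\,f_j\right).$$ Then for any $i\in[n]$, $$\mathbb{E}[|\tilde f_i-f_i|]=\Theta\left(\frac{\log(n/B)}{B}\right),$$ where the implied constants are absolute.
   Context: $[E]$ denotes the indicator of the event $E$ (equal to $1$ if $E$ holds and $0$ otherwise). *)

theory Defs
  imports "HOL-Probability.Probability"
begin

definition zipf :: "nat \<Rightarrow> real" where
  "zipf j = 1 / real j"

text \<open>Joint law of independent hash functions \<open>h 1, \<dots>, h k\<close>, each uniform on the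
  functions \<open>{1..n} \<rightarrow> {1..B}\<close>. The values of \<open>h\<close> outside \<open>{1..k}\<close> (the default argument)
  and of each \<open>h l\<close> outside \<open>{1..n}\<close> are irrelevant. The uniform distribution is only
  meaningful for \<open>B > 0\<close>, so that a hash function exists.\<close>

definition hash_functions :: "nat \<Rightarrow> nat \<Rightarrow> nat \<Rightarrow> (nat \<Rightarrow> nat \<Rightarrow> nat) pmf" where
  "hash_functions n B k =
     Pi_pmf {1..k} undefined (\<lambda>_. pmf_of_set ({1..n} \<rightarrow>\<^sub>E {1..B}))"

definition count_min :: "nat \<Rightarrow> nat \<Rightarrow> (nat \<Rightarrow> nat \<Rightarrow> nat) \<Rightarrow> nat \<Rightarrow> real" where
  "count_min n k h i =
     (MIN l\<in>{1..k}. \<Sum>j\<in>{1..n}. of_bool (h l j = h l i) * zipf j)"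

end

theory Submission
  imports Defs
begin

text \<open>
  The error is \<open>min Z\<^sub>l\<close>, where \<open>Z\<^sub>l\<close> is the total frequency of the other
  elements sharing the bucket of \<open>i\<close> under \<open>h\<^sub>l\<close>.

  Upper bound: split \<open>Z\<^sub>l = H\<^sub>l + L\<^sub>l\<close> into the elements \<open>j \<le> B\<close> and \<open>j > B\<close>. Then
  \<open>min (Z\<^sub>1, Z\<^sub>2) \<le> sqrt H\<^sub>1 * sqrt H\<^sub>2 + L\<^sub>1 + L\<^sub>2\<close>. Subadditivity of the square root bounds
  the mean of \<open>sqrt H\<^sub>l\<close> by the sum of \<open>1 / (B * sqrt j)\<close> over \<open>j \<le> B\<close>, hence by
  \<open>2 / sqrt B\<close>, so independence bounds the heavy part by \<open>4 / B\<close>; the light part has mean at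
  most \<open>ln (n/B) / B\<close>.

  Lower bound: \<open>min Z\<^sub>l \<ge> - ln (\<Sum>l. exp (- t * Z\<^sub>l)) / t\<close>. By Jensen's inequality and
  the product formula for the Laplace transform, the mean of the right-hand side is at least
  \<open>((\<Sum>j\<noteq>i. 1 - exp (- t / j)) / B - ln k) / t\<close>. For \<open>t = 16 * B\<close> the sum over \<open>j\<close> beats
  \<open>ln k \<le> ln (n/B)\<close> by a constant factor.
\<close>

subsection \<open>Elementary estimates\<close>

lemma sqrt_sum_le_sum_sqrt:
  fixes f :: "'a \<Rightarrow> real"
  assumes "\<And>x. x \<in> A \<Longrightarrow> f x \<ge> 0"
  shows "sqrt (\<Sum>x\<in>A. f x) \<le> (\<Sum>x\<in>A. sqrt (f x))"
  using assms
proof (induction A rule: infinite_finite_induct)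
  case (insert x A)
  have "sqrt (f x + sum f A) \<le> sqrt (f x) + sqrt (sum f A)"
    by (rule sqrt_add_le_add_sqrt) (use insert.prems in \<open>auto intro: sum_nonneg\<close>)
  also have "sqrt (sum f A) \<le> (\<Sum>x\<in>A. sqrt (f x))"
    using insert by auto
  finally show ?case
    using insert.hyps by simp
qed auto

lemma sum_inverse_sqrt_le: "(\<Sum>j=1..n. 1 / sqrt (real j)) \<le> 2 * sqrt (real n)"
proof (induction n)
  case (Suc n)
  define a b where "a = sqrt (real n)" and "b = sqrt (real (Suc n))"
  have "a \<ge> 0" "b > 0" "b\<^sup>2 = a\<^sup>2 + 1"
    by (auto simp: a_def b_def)
  moreover have "(b - a)\<^sup>2 \<ge> 0" by simp
  \<comment> \<open>After multiplying by \<open>b\<close> and replacing 1 by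
    \<open>b^2 - a^2\<close>, this is \<open>(b - a)^2 >= 0\<close>; the bounds telescope along the
    induction.\<close>
  ultimately have "1 / b \<le> 2 * b - 2 * a"
    by (simp add: field_simps power2_eq_square)
  with Suc show ?case
    by (simp add: a_def b_def)
qed auto

lemma inverse_le_ln_diff:
  fixes x :: real
  assumes "x > 0"
  shows "1 / (x + 1) \<le> ln (x + 1) - ln x"
proof -
  have "ln (x / (x + 1)) \<le> x / (x + 1) - 1"
    by (rule ln_le_minus_one) (use assms in auto)
  also have "x / (x + 1) - 1 = - (1 / (x + 1))"
    using assms by (simp add: field_simps)
  finally show ?thesis
    using assms by (simp add: ln_div)
qed

lemma ln_diff_le_inverse:
  fixes x :: real
  assumes "x > 0"
  shows "ln (x + 1) - ln x \<le> 1 / x"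
proof -
  have "ln ((x + 1) / x) \<le> (x + 1) / x - 1"
    by (rule ln_le_minus_one) (use assms in auto)
  also have "(x + 1) / x - 1 = 1 / x"
    using assms by (simp add: field_simps)
  finally show ?thesis
    using assms by (simp add: ln_div)
qed

lemma sum_inverse_le_ln:
  assumes "1 \<le> B" "B \<le> n"
  shows "(\<Sum>j\<in>{B<..n}. 1 / real j) \<le> ln (real n / real B)"
  using assms(2)
proof (induction n rule: dec_induct)
  case base
  then show ?case using assms by simp
next
  case (step n)
  have "{B<..Suc n} = insert (Suc n) {B<..n}"
    using step by auto
  then show ?case
    using inverse_le_ln_diff[of "real n"] step assms by (simp add: ln_div algebra_simps)
qed

text \<open>Telescoping \<open>ln_diff_le_inverse\<close>. The sum starts at 2 because the lower
  bound must drop one index \<open>i\<close>, and the largest term, \<open>j = 1\<close>, is the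
  worst one to lose.\<close>

lemma ln_le_sum_shifted_inverse:
  fixes t :: real
  assumes "t \<ge> 0" "1 \<le> n"
  shows "ln ((real n + 1 + t) / (2 + t)) \<le> (\<Sum>j\<in>{2..n}. 1 / (real j + t))"
  using assms(2)
proof (induction n rule: dec_induct)
  case base
  then show ?case using assms by simp
next
  case (step n)
  have "ln ((real (Suc n) + t) + 1) - ln (real (Suc n) + t) \<le> 1 / (real (Suc n) + t)"
    by (rule ln_diff_le_inverse) (use assms in auto)
  moreover have "(\<Sum>j\<in>{2..Suc n}. 1 / (real j + t))
      = (\<Sum>j\<in>{2..n}. 1 / (real j + t)) + 1 / (real (Suc n) + t)"
    using step by simp
  ultimately show ?case
    using step assms by (simp add: ln_div algebra_simps)
qed

lemma one_minus_exp_ge: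
  fixes x :: real
  assumes "x \<ge> 0"
  shows "x / (1 + x) \<le> 1 - exp (- x)"
proof -
  have "exp (- x) \<le> 1 / (1 + x)"
    using exp_ge_add_one_self[of x] assms by (simp add: exp_minus field_simps)
  moreover have "x / (1 + x) = 1 - 1 / (1 + x)"
    using assms by (simp add: field_simps)
  ultimately show ?thesis by simp
qed

text \<open>The factor 9/8 exceeds 1 because a full \<open>ln R\<close> is later spent on
  \<open>ln k\<close>. The difference of the two sides is nondecreasing from 2 on, so the case
  \<open>R = 2\<close> decides.\<close>

lemma ln_ratio_ge:
  fixes R :: real
  assumes "R \<ge> 2"
  shows "9 / 8 * ln R \<le> 16 * ln (1 + (R - 1) / 18)"
proof -
  let ?g = "\<lambda>x::real. 16 * ln (1 + (x - 1) / 18) - 9 / 8 * ln x"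
  have "?g 2 \<le> ?g R"
  proof (rule DERIV_nonneg_imp_nondecreasing[OF assms])
    fix x :: real
    assume x: "2 \<le> x" "x \<le> R"
    have "(?g has_real_derivative (16 * (1 / 18 / (1 + (x - 1) / 18)) - 9 / 8 * (1 / x))) (at x)"
      using x by (auto intro!: derivative_eq_intros simp: add_pos_nonneg)
    moreover have "16 * (1 / 18 / (1 + (x - 1) / 18)) - 9 / 8 * (1 / x) \<ge> 0"
      using x by (simp add: field_simps)
    ultimately show "\<exists>y. (?g has_real_derivative y) (at x) \<and> y \<ge> 0" by blast
  qed
  moreover have "?g 2 \<ge> 0"
  proof -
    \<comment> \<open>The exponent 14 fits because \<open>(19/18)^14 >= 2\<close> and
      \<open>9/8 * 14 <= 16\<close>.\<close>
    have "ln 2 \<le> ln ((19 / 18 :: real) ^ 14)"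
      by (subst ln_le_cancel_iff) (simp_all add: power_divide)
    also have "\<dots> = 14 * ln (19 / 18)"
      by (subst ln_realpow) simp_all
    finally have "ln 2 \<le> 14 * ln (19 / 18 :: real)" .
    moreover have "ln (19 / 18 :: real) \<ge> 0"
      by simp
    ultimately have "9 / 8 * ln 2 \<le> 16 * ln (19 / 18 :: real)"
      by linarith
    then show ?thesis by simp
  qed
  ultimately show ?thesis by linarith
qed

subsection \<open>Collisions under one hash function\<close>

text \<open>Reveal \<open>h i = v\<close> first. The other values are then independent and uniform,
  each hitting \<open>v\<close> with probability \<open>1 / card S\<close>, so the product
  factorizes into terms that do not depend on \<open>v\<close>.\<close>

lemma expectation_prod_collisions:
  fixes F :: "'a \<Rightarrow> bool \<Rightarrow> real"
  assumes "finite A" "i \<in> A" "finite S" "S \<noteq> {}" "\<And>j b. F j b \<ge> 0"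
  shows "measure_pmf.expectation (pmf_of_set (A \<rightarrow>\<^sub>E S)) (\<lambda>h. \<Prod>j\<in>A - {i}. F j (h j = h i))
    = (\<Prod>j\<in>A - {i}. (F j True + (real (card S) - 1) * F j False) / real (card S))"
proof -
  let ?A = "A - {i}" and ?U = "pmf_of_set S"
  let ?P = "Pi_pmf ?A undefined (\<lambda>_. ?U)"
  let ?G = "\<lambda>h. \<Prod>j\<in>?A. F j (h j = h i)"
  have "(A \<rightarrow>\<^sub>E S) = PiE_dflt A undefined (\<lambda>_. S)"
    by (auto simp: PiE_dflt_def PiE_def extensional_def)
  then have "pmf_of_set (A \<rightarrow>\<^sub>E S) = Pi_pmf A undefined (\<lambda>_. ?U)"
    using assms by (simp add: Pi_pmf_of_set)
  also have "\<dots> = Pi_pmf (insert i ?A) undefined (\<lambda>_. ?U)"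
    using assms by (simp add: insert_absorb)
  also have "\<dots> = ?U \<bind> (\<lambda>v. map_pmf (\<lambda>f. f(i := v)) ?P)"
    using assms by (subst Pi_pmf_insert') (auto simp: map_pmf_def)
  finally have hash: "pmf_of_set (A \<rightarrow>\<^sub>E S) = ?U \<bind> (\<lambda>v. map_pmf (\<lambda>f. f(i := v)) ?P)" .
  have fin: "finite (set_pmf ?P)"
    using assms by (auto simp: set_Pi_pmf)
  have cond: "measure_pmf.expectation (map_pmf (\<lambda>f. f(i := v)) ?P) ?G
      = (\<Prod>j\<in>?A. (F j True + (real (card S) - 1) * F j False) / real (card S))"
    if v: "v \<in> S" for v
  proof -
    have "measure_pmf.expectation (map_pmf (\<lambda>f. f(i := v)) ?P) ?G
        = measure_pmf.expectation ?P (\<lambda>f. \<Prod>j\<in>?A. F j (f j = v))"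
      by simp
    also have "\<dots> = (\<Prod>j\<in>?A. measure_pmf.expectation ?U (\<lambda>w. F j (w = v)))"
      using assms by (intro expectation_prod_Pi_pmf integrable_measure_pmf_finite) auto
    also have "\<dots> = (\<Prod>j\<in>?A. (F j True + (real (card S) - 1) * F j False) / real (card S))"
    proof (intro prod.cong refl)
      fix j
      have "(\<Sum>w\<in>S. F j (w = v)) = F j True + (\<Sum>w\<in>S - {v}. F j False)"
        using assms v by (subst sum.remove[of _ v]) (auto intro!: sum.cong)
      also have "(\<Sum>w\<in>S - {v}. F j False) = (real (card S) - 1) * F j False"
        using assms v by (simp add: of_nat_diff card_gt_0_iff Suc_le_eq)
      finally show "measure_pmf.expectation ?U (\<lambda>w. F j (w = v))
          = (F j True + (real (card S) - 1) * F j False) / real (card S)"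
        using assms by (simp add: integral_pmf_of_set)
    qed
    finally show ?thesis .
  qed
  show ?thesis
    unfolding hash using assms fin
    by (subst pmf_expectation_bind_pmf_of_set) (simp_all add: cond del: integral_map_pmf)
qed

lemma expectation_collision:
  assumes "finite A" "i \<in> A" "j \<in> A" "j \<noteq> i" "finite S" "S \<noteq> {}"
  shows "measure_pmf.expectation (pmf_of_set (A \<rightarrow>\<^sub>E S)) (\<lambda>h. of_bool (h j = h i)) = 1 / real (card S)"
proof -
  \<comment> \<open>A single indicator is a product whose other factors are 1; those have mean 1 in
    the product formula.\<close>
  let ?F = "\<lambda>j' b. if j' = j then of_bool b else (1::real)"
  have "card S > 0"
    using assms by (simp add: card_gt_0_iff)
  have "(\<lambda>h. of_bool (h j = h i)) = (\<lambda>h::'a\<Rightarrow>'b. \<Prod>j'\<in>A - {i}. ?F j' (h j' = h i))"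
    using assms by (subst prod.delta) auto
  then have "measure_pmf.expectation (pmf_of_set (A \<rightarrow>\<^sub>E S)) (\<lambda>h. of_bool (h j = h i))
      = (\<Prod>j'\<in>A - {i}. (?F j' True + (real (card S) - 1) * ?F j' False) / real (card S))"
    using assms by (simp only:) (rule expectation_prod_collisions, auto)
  also have "\<dots> = (\<Prod>j'\<in>A - {i}. if j' = j then 1 / real (card S) else 1)"
    using \<open>card S > 0\<close> by (intro prod.cong) (auto simp: field_simps)
  also have "\<dots> = 1 / real (card S)"
    using assms by (subst prod.delta) auto
  finally show ?thesis .
qed

text \<open>The index set is a parameter so that the full error and its heavy and light parts are
  instances of one notion.\<close>

definition collision_mass :: "nat set \<Rightarrow> (nat \<Rightarrow> nat) \<Rightarrow> nat \<Rightarrow> real" where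
  "collision_mass J h i = (\<Sum>j\<in>J. of_bool (h j = h i) * zipf j)"

lemma collision_mass_nonneg: "collision_mass J h i \<ge> 0"
  by (auto simp: collision_mass_def zipf_def intro: sum_nonneg)

abbreviation uniform_hash :: "nat \<Rightarrow> nat \<Rightarrow> (nat \<Rightarrow> nat) pmf" where
  "uniform_hash n B \<equiv> pmf_of_set ({1..n} \<rightarrow>\<^sub>E {1..B})"

text \<open>Finite support settles the integrability conditions below; \<open>1 <= B\<close> ensures
  that there is a hash function to draw.\<close>

lemma finite_set_uniform_hash: "1 \<le> B \<Longrightarrow> finite (set_pmf (uniform_hash n B))"
  by (subst set_pmf_of_set) (auto simp: PiE_eq_empty_iff intro: finite_PiE)

lemma finite_set_hash_functions: "1 \<le> B \<Longrightarrow> finite (set_pmf (hash_functions n B k))"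
  unfolding hash_functions_def by (subst set_Pi_pmf) (auto simp del: One_nat_def intro: finite_set_uniform_hash)

lemma integrable_uniform_hash:
  fixes f :: "_ \<Rightarrow> real"
  shows "1 \<le> B \<Longrightarrow> integrable (measure_pmf (uniform_hash n B)) f"
  by (intro integrable_measure_pmf_finite finite_set_uniform_hash)

lemma integrable_hash_functions:
  fixes f :: "_ \<Rightarrow> real"
  shows "1 \<le> B \<Longrightarrow> integrable (measure_pmf (hash_functions n B k)) f"
  by (intro integrable_measure_pmf_finite finite_set_hash_functions)

lemma expectation_hash_functions_component:
  assumes "l \<in> {1..k}"
  shows "measure_pmf.expectation (hash_functions n B k) (\<lambda>h. f (h l))
    = measure_pmf.expectation (uniform_hash n B) (f :: _ \<Rightarrow> real)"
proof -
  have "map_pmf (\<lambda>h. h l) (hash_functions n B k) = uniform_hash n B"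
    unfolding hash_functions_def using assms by (subst Pi_pmf_component) auto
  then show ?thesis
    by (metis integral_map_pmf)
qed

text \<open>Element \<open>i\<close> always collides with itself, so \<open>zipf i\<close> is a
  common summand of all rows and leaves the minimum; what remains is nonnegative.\<close>

lemma count_min_error:
  assumes "1 \<le> k" "i \<in> {1..n}"
  shows "\<bar>count_min n k h i - zipf i\<bar> = (MIN l\<in>{1..k}. collision_mass ({1..n} - {i}) (h l) i)"
proof -
  let ?Z = "\<lambda>l. collision_mass ({1..n} - {i}) (h l) i"
  have "(\<Sum>j\<in>{1..n}. of_bool (h l j = h l i) * zipf j) = ?Z l + zipf i" for l
    unfolding collision_mass_def using assms(2) by (subst sum.remove[of _ i]) auto
  then have "count_min n k h i = (MIN l\<in>{1..k}. ?Z l + zipf i)"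
    by (simp add: count_min_def)
  also have "\<dots> = (MIN l\<in>{1..k}. ?Z l) + zipf i"
    using assms by (intro Min_add_commute) auto
  finally show ?thesis
    using assms collision_mass_nonneg by (simp add: Min_ge_iff)
qed

subsection \<open>Upper bound\<close>

text \<open>The mean of the heavy mass itself is of order \<open>ln B / B\<close>, too large when
  \<open>n / B\<close> is bounded. Square roots replace the harmonic sum by one of order
  \<open>sqrt B\<close>, and the product of two independent rows restores the scale
  \<open>1 / B\<close>.\<close>

lemma expectation_sqrt_heavy_le:
  assumes "i \<in> {1..n}" "1 \<le> B" "B \<le> n"
  shows "measure_pmf.expectation (uniform_hash n B) (\<lambda>h. sqrt (collision_mass ({1..B} - {i}) h i))
    \<le> 2 / sqrt (real B)"
proof -
  let ?E = "measure_pmf.expectation (uniform_hash n B)"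
  have "?E (\<lambda>h. sqrt (collision_mass ({1..B} - {i}) h i))
      \<le> ?E (\<lambda>h. \<Sum>j\<in>{1..B} - {i}. of_bool (h j = h i) * (1 / sqrt (real j)))"
  proof (intro integral_mono integrable_uniform_hash assms)
    fix h
    have "sqrt (collision_mass ({1..B} - {i}) h i)
        \<le> (\<Sum>j\<in>{1..B} - {i}. sqrt (of_bool (h j = h i) * zipf j))"
      unfolding collision_mass_def by (rule sqrt_sum_le_sum_sqrt) (auto simp: zipf_def)
    also have "\<dots> = (\<Sum>j\<in>{1..B} - {i}. of_bool (h j = h i) * (1 / sqrt (real j)))"
      by (intro sum.cong) (auto simp: zipf_def real_sqrt_divide)
    finally show "sqrt (collision_mass ({1..B} - {i}) h i)
        \<le> (\<Sum>j\<in>{1..B} - {i}. of_bool (h j = h i) * (1 / sqrt (real j)))" .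
  qed
  also have "\<dots> = (\<Sum>j\<in>{1..B} - {i}. ?E (\<lambda>h. of_bool (h j = h i)) * (1 / sqrt (real j)))"
    using assms by (subst Bochner_Integration.integral_sum)
      (auto intro: integrable_uniform_hash simp del: times_divide_eq_right One_nat_def)
  also have "\<dots> = (\<Sum>j\<in>{1..B} - {i}. (1 / real B) * (1 / sqrt (real j)))"
    using assms by (intro sum.cong refl) (subst expectation_collision, auto)
  also have "\<dots> \<le> (\<Sum>j\<in>{1..B}. (1 / real B) * (1 / sqrt (real j)))"
    by (intro sum_mono2) auto
  also have "\<dots> = (1 / real B) * (\<Sum>j\<in>{1..B}. 1 / sqrt (real j))"
    by (rule sum_distrib_left[symmetric])
  also have "\<dots> \<le> (1 / real B) * (2 * sqrt (real B))"
    by (intro mult_left_mono sum_inverse_sqrt_le) auto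
  also have "\<dots> = 2 / sqrt (real B)"
    using assms by (simp add: field_simps)
  finally show ?thesis .
qed

lemma expectation_light_le:
  assumes "i \<in> {1..n}" "1 \<le> B" "B \<le> n"
  shows "measure_pmf.expectation (uniform_hash n B) (\<lambda>h. collision_mass ({B<..n} - {i}) h i)
    \<le> ln (real n / real B) / real B"
proof -
  let ?E = "measure_pmf.expectation (uniform_hash n B)"
  have "?E (\<lambda>h. collision_mass ({B<..n} - {i}) h i)
      = (\<Sum>j\<in>{B<..n} - {i}. ?E (\<lambda>h. of_bool (h j = h i)) * zipf j)"
    unfolding collision_mass_def using assms
    by (subst Bochner_Integration.integral_sum)
      (auto intro: integrable_uniform_hash simp del: One_nat_def)
  also have "\<dots> = (\<Sum>j\<in>{B<..n} - {i}. (1 / real B) * zipf j)"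
    using assms by (intro sum.cong refl) (subst expectation_collision, auto)
  also have "\<dots> \<le> (\<Sum>j\<in>{B<..n}. (1 / real B) * zipf j)"
    by (intro sum_mono2) (auto simp: zipf_def)
  also have "\<dots> = (1 / real B) * (\<Sum>j\<in>{B<..n}. 1 / real j)"
    unfolding zipf_def by (rule sum_distrib_left[symmetric])
  also have "\<dots> \<le> (1 / real B) * ln (real n / real B)"
    using assms by (intro mult_left_mono sum_inverse_le_ln) auto
  finally show ?thesis by simp
qed

text \<open>A minimum is at most the geometric mean. This product form, unlike the minimum, lets
  independence be used.\<close>

lemma min_add_le_sqrt:
  fixes a b c d :: real
  assumes "a \<ge> 0" "b \<ge> 0" "c \<ge> 0" "d \<ge> 0"
  shows "min (a + c) (b + d) \<le> sqrt a * sqrt b + c + d"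
proof -
  have "min a b = sqrt (min a b) * sqrt (min a b)"
    using assms by simp
  also have "\<dots> \<le> sqrt a * sqrt b"
    using assms by (intro mult_mono) auto
  finally show ?thesis
    using assms by linarith
qed

lemma expectation_count_min_error_le:
  assumes "2 \<le> k" "i \<in> {1..n}" "1 \<le> B" "B \<le> n"
  shows "measure_pmf.expectation (hash_functions n B k) (\<lambda>h. \<bar>count_min n k h i - zipf i\<bar>)
    \<le> 4 / real B + 2 * (ln (real n / real B) / real B)"
proof -
  let ?E = "measure_pmf.expectation (hash_functions n B k)"
  let ?E1 = "measure_pmf.expectation (uniform_hash n B)"
  define H where "H = (\<lambda>h. collision_mass ({1..B} - {i}) h i)"
  define L where "L = (\<lambda>h. collision_mass ({B<..n} - {i}) h i)"
  have mass_split: "collision_mass ({1..n} - {i}) h i = H h + L h" for h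
  proof -
    have "{1..n} - {i} = ({1..B} - {i}) \<union> ({B<..n} - {i})"
      using assms by auto
    moreover have "collision_mass (({1..B} - {i}) \<union> ({B<..n} - {i})) h i = H h + L h"
      unfolding H_def L_def collision_mass_def by (rule sum.union_disjoint) auto
    ultimately show ?thesis by metis
  qed
  have "?E (\<lambda>h. \<bar>count_min n k h i - zipf i\<bar>)
      \<le> ?E (\<lambda>h. sqrt (H (h 1)) * sqrt (H (h 2)) + L (h 1) + L (h 2))"
  proof (intro integral_mono integrable_hash_functions assms)
    fix h
    have "\<bar>count_min n k h i - zipf i\<bar> = (MIN l\<in>{1..k}. H (h l) + L (h l))"
      using assms by (simp add: count_min_error mass_split del: One_nat_def)
    \<comment> \<open>Two rows suffice for the upper bound; both exist since
      \<open>2 <= k\<close>.\<close>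
    also have "\<dots> \<le> min (H (h 1) + L (h 1)) (H (h 2) + L (h 2))"
      using assms by (auto intro!: Min_le)
    also have "\<dots> \<le> sqrt (H (h 1)) * sqrt (H (h 2)) + L (h 1) + L (h 2)"
      by (rule min_add_le_sqrt) (auto simp: H_def L_def collision_mass_nonneg)
    finally show "\<bar>count_min n k h i - zipf i\<bar> \<le> sqrt (H (h 1)) * sqrt (H (h 2)) + L (h 1) + L (h 2)" .
  qed
  also have "\<dots> = ?E (\<lambda>h. sqrt (H (h 1)) * sqrt (H (h 2))) + ?E (\<lambda>h. L (h 1)) + ?E (\<lambda>h. L (h 2))"
    using assms by (simp add: integrable_hash_functions)
  also have "?E (\<lambda>h. L (h 1)) = ?E1 L"
    using assms by (intro expectation_hash_functions_component) auto
  also have "?E (\<lambda>h. L (h 2)) = ?E1 L"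
    using assms by (intro expectation_hash_functions_component) auto
  also have "?E (\<lambda>h. sqrt (H (h 1)) * sqrt (H (h 2))) = (?E1 (\<lambda>h. sqrt (H h)))\<^sup>2"
  proof -
    \<comment> \<open>Padding with factors 1 extends the product to all \<open>k\<close> rows, the
      form in which independence under \<open>Pi_pmf\<close> applies.\<close>
    let ?f = "\<lambda>(l::nat) h. if l \<in> {1, 2} then sqrt (H h) else 1"
    have "(\<Prod>l\<in>{1..k}. ?f l (h l)) = sqrt (H (h 1)) * sqrt (H (h 2))" for h
    proof -
      have "(\<Prod>l\<in>{1..k}. ?f l (h l)) = (\<Prod>l\<in>{1, 2}. ?f l (h l))"
        using assms by (intro prod.mono_neutral_right) auto
      then show ?thesis by simp
    qed
    then have "?E (\<lambda>h. sqrt (H (h 1)) * sqrt (H (h 2))) = ?E (\<lambda>h. \<Prod>l\<in>{1..k}. ?f l (h l))"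
      by simp
    also have "\<dots> = (\<Prod>l\<in>{1..k}. ?E1 (?f l))"
      unfolding hash_functions_def using assms
      by (intro expectation_prod_Pi_pmf integrable_uniform_hash)
         (auto simp: H_def collision_mass_nonneg)
    also have "\<dots> = (\<Prod>l\<in>{1, 2}. ?E1 (?f l))"
      using assms by (intro prod.mono_neutral_right) auto
    finally show ?thesis
      by (simp add: power2_eq_square)
  qed
  also have "(?E1 (\<lambda>h. sqrt (H h)))\<^sup>2 \<le> (2 / sqrt (real B))\<^sup>2"
    unfolding H_def using assms
    by (intro power_mono expectation_sqrt_heavy_le integral_nonneg) (auto simp: collision_mass_nonneg)
  also have "(2 / sqrt (real B))\<^sup>2 = 4 / real B"
    by (simp add: power_divide)
  also have "?E1 L \<le> ln (real n / real B) / real B"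
    unfolding L_def using assms by (intro expectation_light_le) auto
  finally show ?thesis by simp
qed

subsection \<open>Lower bound\<close>

text \<open>The exponential turns the mass into a product over \<open>j\<close>. Its factors have
  mean \<open>1 - x\<close> with \<open>x = (1 - exp (- t / j)) / B\<close>, which is at most
  \<open>exp (- x)\<close>.\<close>

lemma expectation_exp_collision_mass_le:
  assumes "i \<in> {1..n}" "1 \<le> B" "t \<ge> 0"
  shows "measure_pmf.expectation (uniform_hash n B)
      (\<lambda>h. exp (- t * collision_mass ({1..n} - {i}) h i))
    \<le> exp (- (\<Sum>j\<in>{1..n} - {i}. (1 - exp (- t / real j)) / real B))"
proof -
  let ?E = "measure_pmf.expectation (uniform_hash n B)"
  let ?F = "\<lambda>j b. exp (- t * (of_bool b * zipf j))"
  have "?E (\<lambda>h. exp (- t * collision_mass ({1..n} - {i}) h i))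
      = ?E (\<lambda>h. \<Prod>j\<in>{1..n} - {i}. ?F j (h j = h i))"
    unfolding collision_mass_def sum_distrib_left by (simp add: exp_sum)
  also have "\<dots> = (\<Prod>j\<in>{1..n} - {i}. (?F j True + (real B - 1) * ?F j False) / real B)"
    using assms by (subst expectation_prod_collisions) auto
  also have "\<dots> \<le> (\<Prod>j\<in>{1..n} - {i}. exp (- ((1 - exp (- t / real j)) / real B)))"
  proof (intro prod_mono conjI)
    fix j
    show "0 \<le> (?F j True + (real B - 1) * ?F j False) / real B"
      using assms by auto
    have "(?F j True + (real B - 1) * ?F j False) / real B = 1 + - ((1 - exp (- t / real j)) / real B)"
      using assms by (simp add: zipf_def field_simps)
    also have "\<dots> \<le> exp (- ((1 - exp (- t / real j)) / real B))"
      by (rule exp_ge_add_one_self)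
    finally show "(?F j True + (real B - 1) * ?F j False) / real B
        \<le> exp (- ((1 - exp (- t / real j)) / real B))" .
  qed
  also have "\<dots> = exp (- (\<Sum>j\<in>{1..n} - {i}. (1 - exp (- t / real j)) / real B))"
    by (simp add: exp_sum flip: sum_negf)
  finally show ?thesis .
qed

lemma sum_one_minus_exp_ge:
  assumes "i \<in> {1..n}" "1 \<le> B" "2 * B \<le> n"
  shows "9 / 8 * ln (real n / real B)
    \<le> (\<Sum>j\<in>{1..n} - {i}. (1 - exp (- (16 * real B) / real j)) / real B)"
proof -
  let ?g = "\<lambda>j::nat. 1 / (real j + 16 * real B)"
  define R where "R = real n / real B"
  have R: "R \<ge> 2" "real n = R * real B"
    using assms by (simp_all add: R_def field_simps flip: of_nat_mult)
  have "9 / 8 * ln R \<le> 16 * ln (1 + (R - 1) / 18)"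
    by (rule ln_ratio_ge) fact
  also have "\<dots> \<le> 16 * ln ((real n + 1 + 16 * real B) / (2 + 16 * real B))"
  proof -
    \<comment> \<open>With \<open>n = R * B\<close>, clearing denominators in the next inequality
      leaves exactly this product; the 18 comes from \<open>2 + 16 * B <= 18 * B\<close>.\<close>
    have "0 \<le> (real B - 1) * (2 * R + 16)"
      using assms R by (intro mult_nonneg_nonneg) auto
    then have "(R - 1) / 18 \<le> (real n - 1) / (2 + 16 * real B)"
      using assms R by (simp add: field_simps)
    then have "1 + (R - 1) / 18 \<le> (real n + 1 + 16 * real B) / (2 + 16 * real B)"
      using assms by (simp add: field_simps)
    then show ?thesis
      using R by (subst mult_le_cancel_left_pos) (auto intro!: ln_mono add_pos_nonneg)
  qed
  also have "\<dots> \<le> 16 * (\<Sum>j\<in>{2..n}. ?g j)"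
    using assms by (intro mult_left_mono ln_le_sum_shifted_inverse) auto
  also have "\<dots> \<le> 16 * (\<Sum>j\<in>{1..n} - {i}. ?g j)"
  proof -
    have "(\<Sum>j\<in>{2..n}. ?g j) = (\<Sum>j\<in>{1..n}. ?g j) - ?g 1"
      using assms by (simp add: sum.atLeast_Suc_atMost numeral_2_eq_2)
    \<comment> \<open>\<open>?g\<close> is decreasing, so omitting \<open>i\<close> costs no more
      than omitting 1.\<close>
    also have "\<dots> \<le> (\<Sum>j\<in>{1..n}. ?g j) - ?g i"
      using assms by (auto intro!: divide_left_mono)
    also have "\<dots> = (\<Sum>j\<in>{1..n} - {i}. ?g j)"
      using assms by (simp add: sum_diff1)
    finally show ?thesis by simp
  qed
  also have "\<dots> \<le> (\<Sum>j\<in>{1..n} - {i}. (1 - exp (- (16 * real B) / real j)) / real B)"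
    unfolding sum_distrib_left
  proof (intro sum_mono)
    fix j
    assume j: "j \<in> {1..n} - {i}"
    define x where "x = 16 * real B / real j"
    have "x / (1 + x) = 16 * real B / (real j + 16 * real B)"
      using j by (simp add: x_def divide_simps)
    then have "16 * ?g j = (x / (1 + x)) / real B"
      using assms by simp
    also have "\<dots> \<le> (1 - exp (- x)) / real B"
      by (intro divide_right_mono one_minus_exp_ge) (auto simp: x_def)
    finally show "16 * ?g j \<le> (1 - exp (- (16 * real B) / real j)) / real B"
      by (simp add: x_def)
  qed
  finally show ?thesis
    by (simp add: R_def)
qed

text \<open>The exponential of \<open>- t\<close> times the minimum is at most the sum of the
  exponentials over \<open>I\<close>. Hence bounds on the individual Laplace transforms are enough,
  at the price of \<open>ln (card I)\<close>.\<close>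

lemma expectation_Min_ge:
  fixes X :: "'b \<Rightarrow> 'a \<Rightarrow> real"
  assumes "finite (set_pmf p)" "finite I" "I \<noteq> {}" "t > 0"
    and "\<And>l. l \<in> I \<Longrightarrow> measure_pmf.expectation p (\<lambda>x. exp (- t * X l x)) \<le> exp (- s)"
  shows "(s - ln (real (card I))) / t \<le> measure_pmf.expectation p (\<lambda>x. MIN l\<in>I. X l x)"
proof -
  let ?E = "measure_pmf.expectation p"
  have int: "integrable (measure_pmf p) f" for f :: "'a \<Rightarrow> real"
    using assms by (intro integrable_measure_pmf_finite)
  define S where "S = (\<lambda>x. \<Sum>l\<in>I. exp (- t * X l x))"
  define m where "m = real (card I) * exp (- s)"
  have "card I > 0"
    using assms by (simp add: card_gt_0_iff)
  then have m: "m > 0" "ln m = ln (real (card I)) - s"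
    by (auto simp: m_def ln_mult)
  have "?E S = (\<Sum>l\<in>I. ?E (\<lambda>x. exp (- t * X l x)))"
    unfolding S_def by (rule Bochner_Integration.integral_sum) (rule int)
  also have "\<dots> \<le> (\<Sum>l\<in>I. exp (- s))"
    using assms(5) by (rule sum_mono)
  finally have ES: "?E S \<le> m"
    by (simp add: m_def)
  \<comment> \<open>Jensen's inequality for the logarithm, via its tangent at \<open>m\<close>.\<close>
  have "1 - ln m - S x / m \<le> t * (MIN l\<in>I. X l x)" for x
  proof -
    have "(MIN l\<in>I. X l x) \<in> (\<lambda>l. X l x) ` I"
      using assms by (intro Min_in) auto
    then obtain l where l: "l \<in> I" "(MIN l\<in>I. X l x) = X l x"
      by auto
    have "exp (- t * X l x) \<le> S x"
      unfolding S_def using assms l by (intro member_le_sum) auto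
    moreover have "ln (exp (- t * X l x) / m) \<le> exp (- t * X l x) / m - 1"
      using m by (intro ln_le_minus_one) auto
    moreover have "ln (exp (- t * X l x) / m) = - t * X l x - ln m"
      using m by (simp add: ln_div)
    ultimately show ?thesis
      using l m divide_right_mono[of "exp (- t * X l x)" "S x" m] by simp
  qed
  then have "?E (\<lambda>x. 1 - ln m - S x / m) \<le> ?E (\<lambda>x. t * (MIN l\<in>I. X l x))"
    by (intro integral_mono int)
  also have "?E (\<lambda>x. 1 - ln m - S x / m) = 1 - ln m - ?E S / m"
    by (simp add: int)
  finally have "1 - ln m - ?E S / m \<le> t * ?E (\<lambda>x. MIN l\<in>I. X l x)"
    by simp
  \<comment> \<open>As \<open>m\<close> bounds the mean of \<open>S\<close>, the averaged tangent is
    at least \<open>- ln m\<close>, which equals \<open>s - ln (card I)\<close>.\<close>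
  moreover have "?E S / m \<le> 1"
    using ES m by simp
  ultimately have "s - ln (real (card I)) \<le> t * ?E (\<lambda>x. MIN l\<in>I. X l x)"
    using m by linarith
  then show ?thesis
    using assms(4) by (simp add: field_simps)
qed

lemma expectation_count_min_error_ge:
  assumes "2 \<le> k" "i \<in> {1..n}" "1 \<le> B" "k * B \<le> n"
  shows "1 / 128 * (ln (real n / real B) / real B)
    \<le> measure_pmf.expectation (hash_functions n B k) (\<lambda>h. \<bar>count_min n k h i - zipf i\<bar>)"
proof -
  \<comment> \<open>Taking \<open>t\<close> proportional to \<open>B\<close> gives the scale
    \<open>1 / B\<close> after division by \<open>t\<close>; the factor 16 makes \<open>s\<close> at
    least 9/8 of \<open>ln (n / B)\<close>.\<close>
  define t where "t = 16 * real B"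
  define s where "s = (\<Sum>j\<in>{1..n} - {i}. (1 - exp (- t / real j)) / real B)"
  have "2 * B \<le> n"
    using assms by (meson mult_le_mono1 order_trans)
  then have s: "9 / 8 * ln (real n / real B) \<le> s"
    unfolding s_def t_def using assms by (intro sum_one_minus_exp_ge) auto
  have "real k * real B \<le> real n"
    using assms(4) by (simp flip: of_nat_mult)
  then have "ln (real k) \<le> ln (real n / real B)"
    using assms by (intro ln_mono) (auto simp: field_simps)
  then have "1 / 8 * ln (real n / real B) \<le> s - ln (real k)"
    using s by linarith
  \<comment> \<open>The surplus \<open>9/8 - 1 = 1/8\<close> divided by 16 is the constant
    1/128.\<close>
  then have "1 / 128 * (ln (real n / real B) / real B) \<le> (s - ln (real k)) / t"
    using assms by (simp add: t_def field_simps)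
  also have "\<dots> \<le> measure_pmf.expectation (hash_functions n B k)
      (\<lambda>h. MIN l\<in>{1..k}. collision_mass ({1..n} - {i}) (h l) i)"
  proof -
    have "measure_pmf.expectation (hash_functions n B k)
        (\<lambda>h. exp (- t * collision_mass ({1..n} - {i}) (h l) i)) \<le> exp (- s)"
      if "l \<in> {1..k}" for l
      unfolding s_def using that assms
      by (subst expectation_hash_functions_component)
         (auto intro!: expectation_exp_collision_mass_le[simplified] simp: t_def)
    then show ?thesis
      using expectation_Min_ge[of "hash_functions n B k" "{1..k}" t
          "\<lambda>l h. collision_mass ({1..n} - {i}) (h l) i" s] assms
      by (simp add: finite_set_hash_functions t_def)
  qed
  also have "\<dots> = measure_pmf.expectation (hash_functions n B k) (\<lambda>h. \<bar>count_min n k h i - zipf i\<bar>)"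
    using assms by (simp add: count_min_error)
  finally show ?thesis .
qed

theorem theorem5:
  "\<exists>c C :: real. 0 < c \<and> 0 < C \<and>
     (\<forall>n B k i :: nat. 2 \<le> k \<longrightarrow> 1 \<le> B \<longrightarrow> real B \<le> real n / real k \<longrightarrow> i \<in> {1..n} \<longrightarrow>
        c * (ln (real n / real B) / real B)
          \<le> measure_pmf.expectation (hash_functions n B k) (\<lambda>h. \<bar>count_min n k h i - zipf i\<bar>) \<and>
        measure_pmf.expectation (hash_functions n B k) (\<lambda>h. \<bar>count_min n k h i - zipf i\<bar>)
          \<le> C * (ln (real n / real B) / real B))"
proof (rule exI[of _ "1 / 128"], rule exI[of _ "2 + 4 / ln 2"], intro conjI allI impI)
  show "0 < 2 + 4 / ln (2::real)"
    by (simp add: add_pos_pos)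
next
  fix n B k i :: nat
  assume k: "2 \<le> k" and B: "1 \<le> B" and le: "real B \<le> real n / real k" and i: "i \<in> {1..n}"
  have "real (k * B) \<le> real n"
    using le k by (simp add: field_simps)
  then have kB: "k * B \<le> n"
    by linarith
  have "2 * B \<le> n"
    using k kB by (meson mult_le_mono1 order_trans)
  show "1 / 128 * (ln (real n / real B) / real B)
      \<le> measure_pmf.expectation (hash_functions n B k) (\<lambda>h. \<bar>count_min n k h i - zipf i\<bar>)"
    using k i B kB by (rule expectation_count_min_error_ge)
  have "measure_pmf.expectation (hash_functions n B k) (\<lambda>h. \<bar>count_min n k h i - zipf i\<bar>)
      \<le> 4 / real B + 2 * (ln (real n / real B) / real B)"
    using k i B \<open>2 * B \<le> n\<close> by (intro expectation_count_min_error_le) auto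
  \<comment> \<open>Since \<open>k >= 2\<close> forces \<open>n / B >= 2\<close>, the logarithm is
    at least \<open>ln 2\<close>, so the heavy contribution is absorbed at the cost of a factor
    \<open>1 / ln 2\<close>.\<close>
  also have "4 / real B \<le> 4 / ln 2 * (ln (real n / real B) / real B)"
  proof -
    have "real (2 * B) \<le> real n"
      using \<open>2 * B \<le> n\<close> by linarith
    then have "ln 2 \<le> ln (real n / real B)"
      using B by (intro ln_mono) (auto simp: field_simps)
    then show ?thesis
      using B by (simp add: field_simps)
  qed
  finally show "measure_pmf.expectation (hash_functions n B k) (\<lambda>h. \<bar>count_min n k h i - zipf i\<bar>)
      \<le> (2 + 4 / ln 2) * (ln (real n / real B) / real B)"
    by (subst distrib_right) linarith
qed simp

end
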